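(* Let $\Delta\neq\mathbb{N}$ be a numerical semigroup, let $d\ge2$ be an integer, and let $a\in\Delta\setminus\{0\}$ with $a+1\in\Delta$. Set $\Delta_d(a)=d\Delta\cup\bigcup_{i=1}^{d-1}(da+i+d\Delta)$, which is a numerical semigroup. Let $\{n_1,\dots,n_e\}$ be the minimal system of generators of $\Delta$. Then $\{dn_1,\dots,dn_e,da+1,da+2,\dots,da+d-1\}$ is the minimal system of generators of $\Delta_d(a)$. In particular, $\operatorname{e}(\Delta_d(a))=\operatorname{e}(\Delta)+d-1$.
   Context: $\mathbb{N}=\{0,1,2,\dots\}$. A numerical semigroup is a submonoid of $(\mathbb{N},+)$ with finite complement in $\mathbb{N}$; each numerical semigroup $S$ has a unique minimal system of generators, whose cardinality is the embedding dimension $\operatorname{e}(S)$. $dA=\{dx: x\in A\}$ and $k+A=\{k+x:x\in A\}$ for $A\subseteq\mathbb{N}$ and $k\in\mathbb{N}$. *)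

theory Defs
  imports "HOL-Algebra.Group" "HOL.Hull"
begin

abbreviation nat_add_monoid :: "nat monoid" where
  "nat_add_monoid \<equiv> \<lparr>carrier = UNIV, mult = (+), one = 0\<rparr>"

definition numerical_semigroup :: "nat set \<Rightarrow> bool" where
  "numerical_semigroup S \<longleftrightarrow> submonoid S nat_add_monoid \<and> finite (UNIV - S)"

definition generated_submonoid :: "nat set \<Rightarrow> nat set" where
  "generated_submonoid A = (\<lambda>T. submonoid T nat_add_monoid) hull A"

definition is_minimal_system_of_generators :: "nat set \<Rightarrow> nat set \<Rightarrow> bool" where
  "is_minimal_system_of_generators S A \<longleftrightarrow>
     generated_submonoid A = S \<and> (\<forall>B. B \<subset> A \<longrightarrow> generated_submonoid B \<noteq> S)"

text \<open>The description below is meaningful for numerical semigroups: existence, uniqueness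
  and finiteness of the minimal system of generators are proved at the end of this theory.\<close>

definition embedding_dimension :: "nat set \<Rightarrow> nat" where
  "embedding_dimension S = card (THE A. is_minimal_system_of_generators S A)"

definition dilate :: "nat \<Rightarrow> nat set \<Rightarrow> nat set" where
  "dilate d A = {d * x | x. x \<in> A}"

definition translate :: "nat \<Rightarrow> nat set \<Rightarrow> nat set" where
  "translate k A = {k + x | x. x \<in> A}"

definition Delta_extension :: "nat set \<Rightarrow> nat \<Rightarrow> nat \<Rightarrow> nat set" where
  "Delta_extension \<Delta> d a =
     dilate d \<Delta> \<union> (\<Union>i\<in>{1..d - 1}. translate (d * a + i) (dilate d \<Delta>))"

lemma submonoid_nat_iff:
  "submonoid S nat_add_monoid \<longleftrightarrow> 0 \<in> S \<and> (\<forall>x\<in>S. \<forall>y\<in>S. x + y \<in> S)"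
  by (auto simp: submonoid_def)

lemma numerical_semigroup_minimal_system:
  assumes S: "numerical_semigroup S"
  shows "\<exists>!A. is_minimal_system_of_generators S A"
    and "is_minimal_system_of_generators S A \<Longrightarrow> finite A"
proof -
  define M where "M = {x \<in> S. x \<noteq> 0 \<and> (\<forall>y\<in>S - {0}. \<forall>z\<in>S - {0}. x \<noteq> y + z)}"
  have sub: "submonoid S nat_add_monoid"
    using S by (simp add: numerical_semigroup_def)
  have zero: "0 \<in> S" and add: "\<And>x y. x \<in> S \<Longrightarrow> y \<in> S \<Longrightarrow> x + y \<in> S"
    using sub by (auto simp: submonoid_nat_iff)
  have least: "M \<subseteq> B" if B: "generated_submonoid B = S" for B
  proof
    fix x assume x: "x \<in> M"
    show "x \<in> B"
    proof (rule ccontr)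
      assume "x \<notin> B"
      moreover have "B \<subseteq> S"
        using B hull_subset unfolding generated_submonoid_def by fastforce
      ultimately have "B \<subseteq> S - {x}" by blast
      moreover have "submonoid (S - {x}) nat_add_monoid"
        unfolding submonoid_nat_iff
      proof (intro conjI ballI)
        show "0 \<in> S - {x}" using x zero by (auto simp: M_def)
        fix y z assume yz: "y \<in> S - {x}" "z \<in> S - {x}"
        have "y + z \<noteq> x"
          using yz x by (cases "y = 0"; cases "z = 0") (auto simp: M_def)
        then show "y + z \<in> S - {x}" using yz add by blast
      qed
      ultimately have "generated_submonoid B \<subseteq> S - {x}"
        unfolding generated_submonoid_def by (rule hull_minimal)
      then show False using B x by (auto simp: M_def)
    qed
  qed
  have gen: "generated_submonoid M = S"
  proof
    show "generated_submonoid M \<subseteq> S"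
      unfolding generated_submonoid_def by (rule hull_minimal) (auto simp: M_def sub)
    have "x \<in> T" if T: "submonoid T nat_add_monoid" "M \<subseteq> T" and "x \<in> S" for x T
      using \<open>x \<in> S\<close>
    proof (induction x rule: less_induct)
      case (less x)
      show ?case
      proof (cases "x = 0 \<or> x \<in> M")
        case True
        then show ?thesis using T by (auto simp: submonoid_nat_iff)
      next
        case False
        then obtain y z where yz: "y \<in> S - {0}" "z \<in> S - {0}" "x = y + z"
          using less.prems unfolding M_def by blast
        then have "y \<in> T" "z \<in> T" using less.IH by auto
        then show ?thesis using T yz by (auto simp: submonoid_nat_iff)
      qed
    qed
    then show "S \<subseteq> generated_submonoid M"
      by (auto simp: generated_submonoid_def hull_def)
  qed
  have iff: "is_minimal_system_of_generators S B \<longleftrightarrow> B = M" for B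
    unfolding is_minimal_system_of_generators_def using least gen by blast
  show "\<exists>!A. is_minimal_system_of_generators S A"
    by (simp add: iff)
  obtain c where c: "UNIV - S \<subseteq> {..<c}"
    using S finite_nat_set_iff_bounded unfolding numerical_semigroup_def by (metis lessThan_iff subsetI)
  have "x < 2 * Suc c" if "x \<in> M" for x
  proof (rule ccontr)
    assume "\<not> x < 2 * Suc c"
    then have "x - Suc c \<in> S - {0}" "Suc c \<in> S - {0}" "x = Suc c + (x - Suc c)"
      using c by (auto simp: subset_iff)
    then show False using that unfolding M_def by blast
  qed
  then have "finite M"
    by (meson bounded_nat_set_is_finite)
  then show "is_minimal_system_of_generators S A \<Longrightarrow> finite A"
    by (simp add: iff)
qed

end

theory Submission
  imports Defs
begin

text \<open>The minimal system of generators of a submonoid of \<open>\<nat>\<close> is its set of atoms, the nonzero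
  elements that are not a sum of two nonzero elements. Writing \<open>x = d * q + r\<close> with \<open>r < d\<close>,
  membership of \<open>x\<close> in the extension means \<open>q \<in> \<Delta>\<close> if \<open>r = 0\<close>, and \<open>q \<in> a + \<Delta>\<close> otherwise.
  In a sum of two elements, a carry of the remainders is absorbed by \<open>2 * a + 1 = a + (a + 1)\<close>,
  and \<open>a + 1 \<in> \<Delta>\<close>. This gives closure under addition; it also shows that a sum of two elements
  with nonzero remainders that is divisible by \<open>d\<close> has a quotient which is not an atom of \<open>\<Delta>\<close>.
  Hence the atoms divisible by \<open>d\<close> are the \<open>d * n\<close> with \<open>n\<close> an atom of \<open>\<Delta>\<close>, while those with
  remainder \<open>i > 0\<close> are just \<open>d * a + i\<close>, the least element of its residue class.\<close>

section \<open>Atoms and minimal systems of generators\<close>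

definition atoms :: "nat set \<Rightarrow> nat set" where
  "atoms S = {x \<in> S. x \<noteq> 0 \<and> (\<forall>y\<in>S - {0}. \<forall>z\<in>S - {0}. x \<noteq> y + z)}"

lemma atomsD: "x \<in> atoms S \<Longrightarrow> y \<in> S \<Longrightarrow> z \<in> S \<Longrightarrow> x = y + z \<Longrightarrow> y = 0 \<or> z = 0"
  by (auto simp: atoms_def)

text \<open>Removing an atom from \<open>S\<close> leaves a submonoid, so generators that avoid the
  atom never produce it.\<close>

lemma atoms_subset_generators:
  assumes S: "submonoid S nat_add_monoid" and B: "generated_submonoid B = S"
  shows "atoms S \<subseteq> B"
proof
  fix x assume x: "x \<in> atoms S"
  show "x \<in> B"
  proof (rule ccontr)
    assume "x \<notin> B"
    moreover have "B \<subseteq> S"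
      using B hull_subset unfolding generated_submonoid_def by fastforce
    ultimately have "B \<subseteq> S - {x}" by blast
    moreover have "submonoid (S - {x}) nat_add_monoid"
      unfolding submonoid_nat_iff
    proof (intro conjI ballI)
      show "0 \<in> S - {x}"
        using S x by (auto simp: submonoid_nat_iff atoms_def)
      fix y z assume yz: "y \<in> S - {x}" "z \<in> S - {x}"
      then have "y + z \<noteq> x" using atomsD[OF x, of y z] by auto
      with yz S show "y + z \<in> S - {x}" by (simp add: submonoid_nat_iff)
    qed
    ultimately have "generated_submonoid B \<subseteq> S - {x}"
      unfolding generated_submonoid_def by (rule hull_minimal)
    with B x show False by (auto simp: atoms_def)
  qed
qed

text \<open>Strong induction: a nonzero non-atom splits into two nonzero, hence strictly smaller,
  summands.\<close>

lemma generated_submonoid_atoms: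
  assumes S: "submonoid S nat_add_monoid"
  shows "generated_submonoid (atoms S) = S"
proof
  show "generated_submonoid (atoms S) \<subseteq> S"
    unfolding generated_submonoid_def by (rule hull_minimal) (auto simp: atoms_def S)
  have "x \<in> T" if T: "submonoid T nat_add_monoid" "atoms S \<subseteq> T" and "x \<in> S" for x T
    using \<open>x \<in> S\<close>
  proof (induction x rule: less_induct)
    case (less x)
    show ?case
    proof (cases "x = 0 \<or> x \<in> atoms S")
      case True
      then show ?thesis using T by (auto simp: submonoid_nat_iff)
    next
      case False
      then obtain y z where "y \<in> S - {0}" "z \<in> S - {0}" "x = y + z"
        using less.prems unfolding atoms_def by blast
      then show ?thesis using T less.IH by (auto simp: submonoid_nat_iff)
    qed
  qed
  then show "S \<subseteq> generated_submonoid (atoms S)"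
    by (auto simp: generated_submonoid_def hull_def)
qed

text \<open>The atoms generate \<open>S\<close> and lie in every generating set; a least generating
  set is the only minimal one.\<close>

lemma is_minimal_system_of_generators_iff:
  assumes "submonoid S nat_add_monoid"
  shows "is_minimal_system_of_generators S B \<longleftrightarrow> B = atoms S"
  unfolding is_minimal_system_of_generators_def
  using atoms_subset_generators[OF assms] generated_submonoid_atoms[OF assms] by blast

lemma embedding_dimension_eq_card_atoms:
  "submonoid S nat_add_monoid \<Longrightarrow> embedding_dimension S = card (atoms S)"
  by (simp add: embedding_dimension_def is_minimal_system_of_generators_iff)

section \<open>Membership in the extension by quotient and remainder\<close>

lemma mem_Delta_extension_iff:
  assumes "r < d"
  shows "d * q + r \<in> Delta_extension \<Delta> d a \<longleftrightarrow> q \<in> (if r = 0 then \<Delta> else translate a \<Delta>)"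
proof -
  have *: "d * q + r = d * q' + r' \<longleftrightarrow> q = q' \<and> r = r'" if "r' < d" for q' r'
  proof
    assume "d * q + r = d * q' + r'"
    then have "(d * q + r) div d = (d * q' + r') div d" "(d * q + r) mod d = (d * q' + r') mod d"
      by simp_all
    with assms that show "q = q' \<and> r = r'" by simp
  qed simp
  have "d * q + r \<in> dilate d \<Delta> \<longleftrightarrow> r = 0 \<and> q \<in> \<Delta>"
    using *[of 0] assms by (auto simp: dilate_def)
  moreover have "d * q + r \<in> translate (d * a + i) (dilate d \<Delta>) \<longleftrightarrow> r = i \<and> q \<in> translate a \<Delta>"
    if "i \<in> {1..d - 1}" for i
  proof -
    have "i < d" using that by auto
    then have eq: "d * q + r = d * a + i + d * x \<longleftrightarrow> q = a + x \<and> r = i" for x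
      using *[of i "a + x"] by (simp add: algebra_simps)
    have "d * q + r \<in> translate (d * a + i) (dilate d \<Delta>)
        \<longleftrightarrow> (\<exists>x\<in>\<Delta>. d * q + r = d * a + i + d * x)"
      unfolding translate_def dilate_def by blast
    then show ?thesis
      unfolding eq by (auto simp: translate_def)
  qed
  ultimately show ?thesis
    using assms by (auto simp: Delta_extension_def)
qed

lemma Delta_extension_cases:
  assumes "x \<in> Delta_extension \<Delta> d a" "d > 0"
  obtains q where "x = d * q" "q \<in> \<Delta>"
  | q i where "x = d * (a + q) + i" "q \<in> \<Delta>" "0 < i" "i < d"
proof -
  have x: "x = d * (x div d) + x mod d" and r: "x mod d < d"
    using assms by simp_all
  have *: "x div d \<in> (if x mod d = 0 then \<Delta> else translate a \<Delta>)"
    using mem_Delta_extension_iff[OF r, of "x div d" \<Delta> a] assms x by simp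
  show thesis
  proof (cases "x mod d = 0")
    case True
    then show thesis using * x that(1)[of "x div d"] by simp
  next
    case False
    then obtain q where "q \<in> \<Delta>" "x div d = a + q" using * by (auto simp: translate_def)
    then show thesis using False x r that(2)[of q "x mod d"] by simp
  qed
qed

lemma dilate_mem_Delta_extension:
  "d > 0 \<Longrightarrow> q \<in> \<Delta> \<Longrightarrow> d * q \<in> Delta_extension \<Delta> d a"
  using mem_Delta_extension_iff[of 0 d q \<Delta> a] by simp

lemma translate_mem_Delta_extension:
  "0 < i \<Longrightarrow> i < d \<Longrightarrow> q \<in> \<Delta> \<Longrightarrow> d * (a + q) + i \<in> Delta_extension \<Delta> d a"
  using mem_Delta_extension_iff[of i d "a + q" \<Delta> a] by (auto simp: translate_def)

section \<open>The extension as a numerical semigroup\<close>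

lemma submonoid_Delta_extension:
  assumes \<Delta>: "submonoid \<Delta> nat_add_monoid" and d: "d > 0"
    and a: "a \<in> \<Delta>" "a + 1 \<in> \<Delta>"
  shows "submonoid (Delta_extension \<Delta> d a) nat_add_monoid"
proof -
  let ?E = "Delta_extension \<Delta> d a"
  have zero: "0 \<in> \<Delta>" and add: "\<And>x y. x \<in> \<Delta> \<Longrightarrow> y \<in> \<Delta> \<Longrightarrow> x + y \<in> \<Delta>"
    using \<Delta> by (auto simp: submonoid_nat_iff)
  \<comment> \<open>A multiple of \<open>d\<close> changes only the quotient, so no carry
    occurs.\<close>
  have mixed: "d * p + (d * (a + q) + i) \<in> ?E"
    if "p \<in> \<Delta>" "q \<in> \<Delta>" "0 < i" "i < d" for p q i
    using translate_mem_Delta_extension[of i d "p + q" \<Delta> a] add that by (simp add: algebra_simps)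
  have "x + y \<in> ?E" if x: "x \<in> ?E" and y: "y \<in> ?E" for x y
    using x d
  proof (cases rule: Delta_extension_cases)
    case x: (1 p)
    show ?thesis using y d
    proof (cases rule: Delta_extension_cases)
      case (1 q)
      then show ?thesis
        using x dilate_mem_Delta_extension[of d "p + q" \<Delta> a] d add by (simp add: algebra_simps)
    next
      case (2 q j)
      then show ?thesis using x mixed by simp
    qed
  next
    case x: (2 p i)
    show ?thesis using y d
    proof (cases rule: Delta_extension_cases)
      case (1 q)
      then show ?thesis using x mixed[of q p i] by (simp add: add.commute)
    next
      case y: (2 q j)
      \<comment> \<open>The quotients contribute \<open>2 * a\<close>. If the sum has a nonzero
        remainder, one \<open>a\<close> remains as the offset and the other, plus a possible carry,
        goes into \<Delta>. If \<open>i + j = d\<close>, no offset is required and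
        \<open>a + (a + 1)\<close> goes into \<Delta>.\<close>
      consider "i + j < d" | "i + j = d" | "d < i + j" by linarith
      then show ?thesis
      proof cases
        case 1
        have "x + y = d * (a + (a + p + q)) + (i + j)"
          using x y by (simp add: algebra_simps)
        moreover have "d * (a + (a + p + q)) + (i + j) \<in> ?E"
          using x y a add 1 by (intro translate_mem_Delta_extension) auto
        ultimately show ?thesis by (simp only:)
      next
        case 2
        then have "x + y = d * (a + (a + 1) + p + q)"
          using x y by (simp add: algebra_simps)
        moreover have "a + (a + 1) + p + q \<in> \<Delta>"
          using x y a add by blast
        ultimately show ?thesis
          using dilate_mem_Delta_extension d by metis
      next
        case 3
        then have "x + y = d * (a + (a + 1 + p + q)) + (i + j - d)"
          using x y by (simp add: algebra_simps)
        moreover have "a + 1 + p + q \<in> \<Delta>"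
          using x y a add by blast
        moreover have "0 < i + j - d" "i + j - d < d"
          using 3 x y by linarith+
        ultimately show ?thesis
          by (simp only: translate_mem_Delta_extension)
      qed
    qed
  qed
  moreover have "0 \<in> ?E"
    using dilate_mem_Delta_extension[OF d zero, of a] by simp
  ultimately show ?thesis
    by (auto simp: submonoid_nat_iff)
qed

lemma numerical_semigroup_Delta_extension:
  assumes \<Delta>: "numerical_semigroup \<Delta>" and d: "d > 0"
    and a: "a \<in> \<Delta>" "a + 1 \<in> \<Delta>"
  shows "numerical_semigroup (Delta_extension \<Delta> d a)"
proof -
  obtain c where c: "UNIV - \<Delta> \<subseteq> {..<c}"
    using \<Delta> finite_nat_set_iff_bounded unfolding numerical_semigroup_def
    by (metis lessThan_iff subsetI)
  \<comment> \<open>All gaps of \<Delta> are below \<open>c\<close>. From \<open>d * (a + c)\<close>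
    on, both the quotient and the quotient minus \<open>a\<close> are at least \<open>c\<close>,
    which settles every remainder.\<close>
  have "x \<in> Delta_extension \<Delta> d a" if "d * (a + c) \<le> x" for x
  proof -
    have "a + c \<le> x div d"
      using div_le_mono[OF that, of d] d by simp
    then have "x div d \<in> \<Delta>" "x div d \<in> translate a \<Delta>"
      using c by (auto simp: translate_def subset_iff intro!: exI[of _ "x div d - a"])
    then have "d * (x div d) + x mod d \<in> Delta_extension \<Delta> d a"
      using mem_Delta_extension_iff[of "x mod d" d "x div d" \<Delta> a] d by simp
    then show ?thesis by simp
  qed
  then have "UNIV - Delta_extension \<Delta> d a \<subseteq> {..<d * (a + c)}"
    by (auto simp: not_le[symmetric])
  with submonoid_Delta_extension[OF _ d a] \<Delta> show ?thesis
    unfolding numerical_semigroup_def using finite_subset by blast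
qed

section \<open>Atoms of the extension\<close>

lemma atoms_Delta_extension:
  assumes \<Delta>: "submonoid \<Delta> nat_add_monoid" and d: "d > 0"
    and a: "a \<in> \<Delta>" "a \<noteq> 0" "a + 1 \<in> \<Delta>"
  shows "atoms (Delta_extension \<Delta> d a)
    = {d * n | n. n \<in> atoms \<Delta>} \<union> {d * a + i | i. i \<in> {1..d - 1}}"
    (is "atoms ?E = ?D \<union> ?I")
proof (intro equalityI subsetI)
  have zero: "0 \<in> \<Delta>" and add: "\<And>x y. x \<in> \<Delta> \<Longrightarrow> y \<in> \<Delta> \<Longrightarrow> x + y \<in> \<Delta>"
    using \<Delta> by (auto simp: submonoid_nat_iff)
  fix x
  {
    assume x: "x \<in> atoms ?E"
    then have "x \<in> ?E" "x \<noteq> 0" by (auto simp: atoms_def)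
    from \<open>x \<in> ?E\<close> d show "x \<in> ?D \<union> ?I"
    proof (cases rule: Delta_extension_cases)
      case (1 q)
      have "y = 0 \<or> z = 0" if "y \<in> \<Delta>" "z \<in> \<Delta>" "q = y + z" for y z
        using atomsD[OF x, of "d * y" "d * z"] dilate_mem_Delta_extension d that 1
        by (simp add: algebra_simps)
      with 1 \<open>x \<noteq> 0\<close> have "q \<in> atoms \<Delta>"
        by (auto simp: atoms_def)
      with 1 show ?thesis by blast
    next
      case (2 q i)
      \<comment> \<open>Splitting off the least element of the residue class leaves
        \<open>d * q\<close>, so atomicity forces \<open>q = 0\<close>.\<close>
      have "d * (a + 0) + i = 0 \<or> d * q = 0"
        using x
      proof (rule atomsD)
        show "d * (a + 0) + i \<in> ?E" "d * q \<in> ?E"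
          using 2 d zero translate_mem_Delta_extension dilate_mem_Delta_extension by blast+
        show "x = d * (a + 0) + i + d * q"
          using 2 by (simp add: algebra_simps)
      qed
      with 2 d show ?thesis by auto
    qed
  }
  assume "x \<in> ?D \<union> ?I"
  then consider n where "x = d * n" "n \<in> atoms \<Delta>"
    | i where "x = d * a + i" "0 < i" "i < d"
    by auto
  then show "x \<in> atoms ?E"
  proof cases
    case n: (1 n)
    have "y = 0 \<or> z = 0" if y: "y \<in> ?E" and z: "z \<in> ?E" and sum: "x = y + z" for y z
      using y d
    proof (cases rule: Delta_extension_cases)
      case y: (1 p)
      show ?thesis using z d
      proof (cases rule: Delta_extension_cases)
        case z: (1 q)
        have "d * n = d * (p + q)"
          using n y z sum by (simp add: algebra_simps)
        then have "n = p + q" using d by simp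
        then show ?thesis using atomsD[OF n(2)] y z by auto
      next
        case z: (2 q j)
        \<comment> \<open>With exactly one summand divisible by \<open>d\<close>, the sum has a
          nonzero remainder.\<close>
        have "d * n = d * (p + a + q) + j"
          using n y z sum by (simp add: algebra_simps)
        then have "(d * n) mod d = (d * (p + a + q) + j) mod d" by simp
        with z show ?thesis by simp
      qed
    next
      case y: (2 p i)
      show ?thesis using z d
      proof (cases rule: Delta_extension_cases)
        case z: (1 q)
        have "d * n = d * (p + a + q) + i"
          using n y z sum by (simp add: algebra_simps)
        then have "(d * n) mod d = (d * (p + a + q) + i) mod d" by simp
        with y show ?thesis by simp
      next
        case z: (2 q j)
        have eq: "d * n = d * (a + a + p + q) + (i + j)"
          using n y z sum by (simp add: algebra_simps)
        have "d dvd i + j"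
          using eq by (metis dvd_add_right_iff dvd_triv_left)
        then obtain k where k: "i + j = d * k" ..
        \<comment> \<open>Both remainders lie strictly between 0 and \<open>d\<close>, so
          \<open>d\<close> is the only possible multiple.\<close>
        with y z have "d * k < d * 2" "0 < d * k" by linarith+
        then have "k = 1" by simp
        with k have "i + j = d" by simp
        with eq have "d * n = d * (a + (a + 1 + p + q))"
          by (simp add: algebra_simps)
        then have "n = a + (a + 1 + p + q)" using nat_mult_eq_cancel1[OF d] by blast
        moreover have "a + 1 + p + q \<in> \<Delta>"
          using y z a add by blast
        \<comment> \<open>The atom \<open>n\<close> would be a sum of two nonzero elements of
          \<Delta>, as \<open>a\<close> is nonzero.\<close>
        ultimately show ?thesis
          using atomsD[OF n(2), of a "a + 1 + p + q"] a by simp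
      qed
    qed
    moreover have "x \<in> ?E" "x \<noteq> 0"
      using n d dilate_mem_Delta_extension by (auto simp: atoms_def)
    ultimately show ?thesis by (auto simp: atoms_def)
  next
    case i: (2 i)
    \<comment> \<open>This gives \<open>x < 2 * (d * a)\<close>, so one of any two summands of
      \<open>x\<close> is below \<open>d * a\<close>.\<close>
    have da: "d \<le> d * a" using a by simp
    \<comment> \<open>Below \<open>d * a\<close> the extension contains only multiples of
      \<open>d\<close>. The other summand then carries the remainder \<open>i\<close> and has
      quotient at least \<open>a\<close>, which is already the quotient of \<open>x\<close>.\<close>
    have small: "y = 0" if y: "y \<in> ?E" "y < d * a" and yz: "x = y + z" and z: "z \<in> ?E" for y z
    proof -
      from y(1) d obtain p where p: "y = d * p"
      proof (cases rule: Delta_extension_cases)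
        case (2 p j)
        with y(2) show thesis by (simp add: distrib_left)
      qed (use that in blast)
      from z d show "y = 0"
      proof (cases rule: Delta_extension_cases)
        case (1 q)
        then have "d * a + i = d * (p + q)"
          using i p yz by (simp add: algebra_simps)
        then have "(d * a + i) mod d = (d * (p + q)) mod d" by simp
        with i show ?thesis by simp
      next
        case (2 q j)
        then have "d * a + i = d * (p + a + q) + j"
          using i p yz by (simp add: algebra_simps)
        then have "(d * a + i) div d = (d * (p + a + q) + j) div d" by simp
        with i 2 p show ?thesis by simp
      qed
    qed
    have "y = 0 \<or> z = 0" if yz: "y \<in> ?E" "z \<in> ?E" "x = y + z" for y z
    proof -
      have "y < d * a \<or> z < d * a"
        using yz(3) i da by linarith
      then show ?thesis
        using small[of y z] small[of z y] yz by (auto simp: add.commute)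
    qed
    moreover have "x \<in> ?E"
      using translate_mem_Delta_extension[of i d 0 \<Delta> a] i zero by simp
    ultimately show ?thesis using i by (auto simp: atoms_def)
  qed
qed

theorem proposition3p2:
  fixes \<Delta> :: "nat set" and d a :: nat
  assumes "numerical_semigroup \<Delta>"
    and "\<Delta> \<noteq> UNIV"
    and "d \<ge> 2"
    and "a \<in> \<Delta> - {0}"
    and "a + 1 \<in> \<Delta>"
  shows "numerical_semigroup (Delta_extension \<Delta> d a)
    \<and> (\<forall>A. is_minimal_system_of_generators \<Delta> A \<longrightarrow>
          is_minimal_system_of_generators (Delta_extension \<Delta> d a)
            ({d * n | n. n \<in> A} \<union> {d * a + i | i. i \<in> {1..d - 1}}))
    \<and> embedding_dimension (Delta_extension \<Delta> d a) = embedding_dimension \<Delta> + d - 1"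
proof -
  let ?E = "Delta_extension \<Delta> d a"
  let ?D = "{d * n | n. n \<in> atoms \<Delta>}" and ?I = "{d * a + i | i. i \<in> {1..d - 1}}"
  have d: "d > 0" using assms by simp
  have sub: "submonoid \<Delta> nat_add_monoid"
    using assms by (simp add: numerical_semigroup_def)
  have E: "numerical_semigroup ?E"
    using numerical_semigroup_Delta_extension d assms by simp
  then have subE: "submonoid ?E nat_add_monoid"
    by (simp add: numerical_semigroup_def)
  have atoms: "atoms ?E = ?D \<union> ?I"
    using atoms_Delta_extension[OF sub d] assms by simp
  have fin: "finite (atoms \<Delta>)"
    using numerical_semigroup_minimal_system(2)[OF assms(1)]
    by (simp add: is_minimal_system_of_generators_iff[OF sub])
  have D: "?D = (*) d ` atoms \<Delta>" and I: "?I = (+) (d * a) ` {1..d - 1}"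
    by blast+
  \<comment> \<open>Residues modulo \<open>d\<close> separate the two families.\<close>
  have "?D \<inter> ?I = {}"
  proof -
    have "d * n \<noteq> d * a + i" if "i \<in> {1..d - 1}" for n i
    proof
      assume "d * n = d * a + i"
      then have "(d * n) mod d = (d * a + i) mod d" by simp
      moreover have "0 < i" "i < d" using that by auto
      ultimately show False by simp
    qed
    then show ?thesis by blast
  qed
  moreover have "card ?D = card (atoms \<Delta>)"
    unfolding D using d by (intro card_image inj_onI) simp
  moreover have "card ?I = d - 1"
    unfolding I by (subst card_image) auto
  ultimately have "card (?D \<union> ?I) = card (atoms \<Delta>) + (d - 1)"
    using card_Un_disjoint[of ?D ?I] fin D I by simp
  \<comment> \<open>Since \<open>d > 0\<close>, the truncated subtraction can be moved outside the
    sum.\<close>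
  then have "embedding_dimension ?E = embedding_dimension \<Delta> + d - 1"
    using embedding_dimension_eq_card_atoms sub subE atoms d by simp
  \<comment> \<open>The only admissible \<open>A\<close> is \<open>atoms \<Delta>\<close>.\<close>
  with E atoms show ?thesis
    by (simp add: is_minimal_system_of_generators_iff[OF sub]
        is_minimal_system_of_generators_iff[OF subE])
qed

end
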